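(* Let $0<s<1$ and let $\eta_{t,s}$, $t>0$, be the subordination densities on $(0,\infty)$ defined in the context. There is a constant $C>0$ depending only on $s$ such that for every $u>0$ $$\int_0^\infty\Big|\frac{\partial}{\partial t}\eta_{t,s}(u)\Big|\,dt\leq\frac{C}{u}.$$
   Context: For $0<s<1$ and $t>0$, $\eta_{t,s}$ is the probability density on $(0,\infty)$ appearing in Bochner's subordination formula $e^{-tA^s}=\int_0^\infty e^{-uA}\,\eta_{t,s}(u)\,du$; that is, it is the (continuous) density characterized by $\int_0^\infty e^{-u\lambda}\eta_{t,s}(u)\,du=e^{-t\lambda^s}$ for all $\lambda\ge0$. *)

theory Defs
  imports "HOL-Analysis.Analysis"
begin

(* The Laplace transform condition at x = 0 (where 0 powr s = 0) says that f has total mass 1.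
   Among functions that are continuous on (0,\<infinity>) the conditions determine f there; values of f
   outside (0,\<infinity>) play no role. *)
definition subordination_density :: "real \<Rightarrow> real \<Rightarrow> (real \<Rightarrow> real) \<Rightarrow> bool" where
  "subordination_density s t f \<longleftrightarrow>
     continuous_on {0<..} f \<and>
     (\<forall>u>0. 0 \<le> f u) \<and>
     (\<forall>x\<ge>0. set_integrable lborel {0<..} (\<lambda>u. exp (- u * x) * f u) \<and>
             (LBINT u:{0<..}. exp (- u * x) * f u) = exp (- t * x powr s))"

end

theory Submission
  imports Defs "HOL-Complex_Analysis.Complex_Analysis" "HOL-Real_Asymp.Real_Asymp"
begin

text \<open>
  Rotating the Bromwich contour to the rays \<open>arg z = \<plusminus>\<phi>\<close> with \<open>pi / 2 < \<phi>\<close> and \<open>s * \<phi> < pi / 2\<close>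
  represents the density \<open>\<eta> t u\<close> as the integral of
  \<open>Im (exp (u z - t z^s)) / pi\<close> along the upper ray. On that ray both \<open>exp (u z)\<close> and \<open>exp (- t z^s)\<close> decay
  exponentially, so with \<open>\<kappa> = cos (s * \<phi>)\<close> the \<open>t\<close>-derivative of the integrand is at most
  \<open>r^s exp (- t \<kappa> r^s) exp (- u \<kappa> r)\<close> at \<open>|z| = r\<close>. By Tonelli, integrating first in \<open>t\<close> and then
  in \<open>r\<close> gives \<open>1 / (\<kappa>\<^sup>2 u)\<close>. The representation itself follows from uniqueness
  of Laplace transforms, since the residue theorem computes the Laplace transform of the contour integral.
\<close>

subsection \<open>Exponential integrals\<close>

text \<open>With v = \<open>exp (a * y)\<close> this is 1 / a times the integral of exp (- b v) over
  v > 0. Both the integrals in r and those in r^s take this shape once r = exp y.\<close>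

lemma has_bochner_integral_exp_exp:
  fixes a b :: real
  assumes "a > 0" "b > 0"
  shows "has_bochner_integral lborel (\<lambda>y. exp (a * y - b * exp (a * y))) (1 / (a * b))"
proof -
  define F where "F = (\<lambda>y. - exp (- b * exp (a * y)) / (a * b))"
  define f where "f = (\<lambda>y. exp (a * y - b * exp (a * y)))"
  have D: "DERIV F y :> f y" for y
    using assms unfolding F_def f_def
    by (auto intro!: derivative_eq_intros simp: field_simps exp_diff exp_minus)
  have bot: "(F \<longlongrightarrow> - 1 / (a * b)) at_bot"
  proof -
    have "((\<lambda>y. exp (a * y)) \<longlongrightarrow> 0) at_bot"
      using assms by real_asymp
    from tendsto_mult[OF tendsto_const this, of "-b"]
    have "((\<lambda>y. - exp (- b * exp (a * y)) / (a * b)) \<longlongrightarrow> - exp 0 / (a * b)) at_bot"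
      using assms by (intro tendsto_intros) auto
    then show ?thesis by (simp add: F_def)
  qed
  have top: "(F \<longlongrightarrow> 0) at_top"
    unfolding F_def using assms by real_asymp
  have 1: "set_integrable lborel (einterval (-\<infinity>) \<infinity>) f" "(LBINT y=-\<infinity>..\<infinity>. f y) = 0 - (- 1 / (a * b))"
    by (rule interval_integral_FTC_nonneg[where F = F];
        use D bot top in \<open>auto simp: ereal_tendsto_simps f_def intro!: continuous_intros\<close>)+
  from 1 show ?thesis
    by (simp add: interval_lebesgue_integral_def set_integrable_def set_lebesgue_integral_def
        has_bochner_integral_iff f_def)
qed

lemma halfline_exp_integral_real:
  fixes c :: real
  assumes "c > 0"
  shows "set_integrable lborel {0<..} (\<lambda>u. exp (- u * c))"
    and "(LBINT u:{0<..}. exp (- u * c)) = 1 / c"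
proof -
  have "((\<lambda>u. - exp (- u * c) / c) \<longlongrightarrow> - exp (- 0 * c) / c) (at_right 0)"
    using assms by (intro tendsto_intros) auto
  then have 0: "((\<lambda>u. - exp (- u * c) / c) \<longlongrightarrow> - 1 / c) (at_right 0)" by simp
  have i: "((\<lambda>u. - exp (- u * c) / c) \<longlongrightarrow> 0) at_top"
    using assms by real_asymp
  have D: "DERIV (\<lambda>u. - exp (- u * c) / c) x :> exp (- x * c)" for x
    using assms by (auto intro!: derivative_eq_intros simp: field_simps)
  have "set_integrable lborel (einterval 0 \<infinity>) (\<lambda>u. exp (- u * c))"
     "(LBINT u=0..\<infinity>. exp (- u * c)) = 0 - (- 1 / c)"
    by (rule interval_integral_FTC_nonneg[where F = "\<lambda>u. - exp (- u * c) / c"];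
      use D 0 i in \<open>auto simp: ereal_tendsto_simps zero_ereal_def intro!: continuous_intros\<close>)+
  then show "set_integrable lborel {0<..} (\<lambda>u. exp (- u * c))" "(LBINT u:{0<..}. exp (- u * c)) = 1 / c"
    by (simp_all add: interval_lebesgue_integral_def zero_ereal_def)
qed

lemma halfline_exp_integral:
  fixes z :: complex
  assumes "Re z > 0"
  shows "set_integrable lborel {0<..} (\<lambda>u. exp (- of_real u * z))"
    and "(LBINT u:{0<..}. exp (- of_real u * z)) = 1 / z"
proof -
  have z: "z \<noteq> 0" using assms by auto
  have e: "einterval 0 \<infinity> = {0<..}" by (simp add: zero_ereal_def)
  show 2: "set_integrable lborel {0<..} (\<lambda>u. exp (- of_real u * z))"
  proof (rule set_integrable_bound[OF halfline_exp_integral_real(1)[OF assms]])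
    show "set_borel_measurable lborel {0<..} (\<lambda>x. exp (- of_real x * z))"
      unfolding set_borel_measurable_def
      by (intro borel_measurable_scaleR borel_measurable_indicator)
         (auto intro!: borel_measurable_continuous_onI continuous_intros)
  qed auto
  have "(LBINT u=0..\<infinity>. exp (- of_real u * z)) = 0 - (- 1 / z)"
  proof (rule interval_integral_FTC_integrable[where F = "\<lambda>u. - exp (- of_real u * z) / z"])
    show "((\<lambda>u. - exp (- of_real u * z) / z) has_vector_derivative exp (- of_real x * z)) (at x)" for x
      using z by (auto intro!: derivative_eq_intros has_vector_derivative_real_field simp: field_simps)
    have "((\<lambda>u. - exp (- complex_of_real u * z) / z) \<longlongrightarrow> - exp (- of_real 0 * z) / z) (at_right 0)"
      using z by (intro tendsto_intros) auto
    then show "(((\<lambda>u. - exp (- complex_of_real u * z) / z) \<circ> real_of_ereal) \<longlongrightarrow> - 1 / z) (at_right 0)"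
      by (simp add: ereal_tendsto_simps zero_ereal_def)
    have "((\<lambda>u. norm (- exp (- complex_of_real u * z) / z)) \<longlongrightarrow> 0) at_top"
    proof -
      have "((\<lambda>u. exp (- u * Re z) / norm z) \<longlongrightarrow> 0) at_top"
        using assms z by real_asymp
      then show ?thesis by (simp add: norm_divide)
    qed
    then have "((\<lambda>u. - exp (- complex_of_real u * z) / z) \<longlongrightarrow> 0) at_top"
      by (simp only: tendsto_norm_zero_iff)
    then show "(((\<lambda>u. - exp (- complex_of_real u * z) / z) \<circ> real_of_ereal) \<longlongrightarrow> 0) (at_left \<infinity>)"
      by (simp only: ereal_tendsto_simps)
  qed (use 2 e in \<open>auto intro!: continuous_intros\<close>)
  then show "(LBINT u:{0<..}. exp (- of_real u * z)) = 1 / z"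
    by (simp add: interval_lebesgue_integral_def e)
qed

lemma mult_exp_minus_le:
  fixes c v :: real
  assumes "c > 0"
  shows "v * exp (- c * v) \<le> 1 / c"
proof -
  have "c * v \<le> exp (c * v)"
    using exp_ge_add_one_self[of "c * v"] by linarith
  then show ?thesis using assms by (simp add: exp_minus field_simps)
qed

subsection \<open>Uniqueness of Laplace transforms\<close>

text \<open>If \<open>g u0 > 0\<close>, test \<open>g\<close> against a bump function of \<open>exp (- u)\<close> supported where \<open>g > 0\<close>; by Weierstrass
  the bump is a uniform limit of polynomials in \<open>exp (- u)\<close>, against which \<open>g\<close> integrates to zero.\<close>

lemma laplace_unique_nonpos:
  fixes g :: "real \<Rightarrow> real"
  assumes cont: "continuous_on {0<..} g"
    and int: "\<And>n::nat. n \<ge> 1 \<Longrightarrow> set_integrable lborel {0<..} (\<lambda>u. exp (- u * real n) * g u)"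
    and zero: "\<And>n::nat. n \<ge> 1 \<Longrightarrow> (LBINT u:{0<..}. exp (- u * real n) * g u) = 0"
    and "u0 > 0"
  shows "g u0 \<le> 0"
proof (rule ccontr)
  assume "\<not> g u0 \<le> 0"
  then have gu0: "g u0 > 0" by simp
  \<comment> \<open>One factor \<open>exp (- u)\<close> is absorbed into \<open>G\<close>, so that
    constant polynomials in \<open>exp (- u)\<close> correspond to the exponent n = 1, the first one
    available.\<close>
  define G where "G = (\<lambda>u. exp (- u) * g u)"
  have G_int: "set_integrable lborel {0<..} G"
    using int[of 1] by (simp add: G_def)
  have poly: "set_integrable lborel {0<..} (\<lambda>u. q (exp (- u)) * G u) \<and> (LBINT u:{0<..}. q (exp (- u)) * G u) = 0"
    if q: "real_polynomial_function q" for q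
  proof -
    obtain a n where q: "q = (\<lambda>x. \<Sum>i\<le>n. a i * x ^ i)"
      using q by (auto simp: real_polynomial_function_iff_sum)
    have exp_Suc: "exp (- u * real (Suc i)) = exp (- u) ^ i * exp (- u)" for u i
      by (metis exp_of_nat2_mult power_Suc2)
    have eq: "q (exp (- u)) * G u = (\<Sum>i\<le>n. a i * (exp (- u * real (Suc i)) * g u))" for u
      unfolding q G_def sum_distrib_right
      by (intro sum.cong refl) (simp only: exp_Suc mult_ac)
    have i: "set_integrable lborel {0<..} (\<lambda>u. a i * (exp (- u * real (Suc i)) * g u))" for i
      by (intro set_integrable_mult_right int) auto
    show ?thesis
      unfolding eq
    proof
      show "set_integrable lborel {0<..} (\<lambda>u. \<Sum>i\<le>n. a i * (exp (- u * real (Suc i)) * g u))"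
        using i unfolding set_integrable_def scaleR_sum_right by (intro Bochner_Integration.integrable_sum) auto
      have "(LBINT u:{0<..}. (\<Sum>i\<le>n. a i * (exp (- u * real (Suc i)) * g u)))
          = (\<Sum>i\<le>n. (LBINT u:{0<..}. a i * (exp (- u * real (Suc i)) * g u)))"
        using i unfolding set_integrable_def set_lebesgue_integral_def scaleR_sum_right
        by (intro Bochner_Integration.integral_sum) auto
      also have "\<dots> = 0"
        using zero by (intro sum.neutral) (auto simp: set_integral_mult_right simp del: of_nat_Suc)
      finally show "(LBINT u:{0<..}. (\<Sum>i\<le>n. a i * (exp (- u * real (Suc i)) * g u))) = 0" .
    qed
  qed
  have cont0: "isCont g u0"
    using cont assms(4) by (simp add: continuous_on_eq_continuous_at)
  have "\<forall>\<^sub>F u in at u0. g u > 0"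
    using cont0 gu0 by (auto simp: isCont_def intro: order_tendstoD(1))
  then obtain d0 where d0: "d0 > 0" "\<And>u. dist u u0 < d0 \<Longrightarrow> g u > 0"
    using gu0 unfolding eventually_at by (metis UNIV_I)
  \<comment> \<open>Half the minimum keeps the interval of radius \<open>d\<close> about
    \<open>u0\<close> inside both the positive half-line and the neighbourhood on which
    \<open>g\<close> is positive.\<close>
  define d where "d = min d0 u0 / 2"
  have d: "d > 0" "d < u0" "d < d0" using d0 assms(4) by (auto simp: d_def min_def)
  have pos: "g u > 0" if "u0 - d < u" "u < u0 + d" for u
    using d0(2)[of u] that d by (auto simp: dist_real_def)
  \<comment> \<open>The positive part of a quadratic in x whose roots are the images of
    \<open>u0 + d\<close> and \<open>u0 - d\<close> under u |-> \<open>exp (- u)\<close>.\<close>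
  define b where "b = (\<lambda>x. max 0 ((x - exp (- (u0 + d))) * (exp (- (u0 - d)) - x)))"
  have b_cont: "continuous_on A b" for A unfolding b_def by (intro continuous_intros)
  have b_nonneg: "b x \<ge> 0" for x by (simp add: b_def)
  have b_pos: "b (exp (-u)) > 0 \<longleftrightarrow> u0 - d < u \<and> u < u0 + d" for u
    using d by (auto simp: b_def less_max_iff_disj zero_less_mult_iff)
  have bG: "b (exp (-u)) * G u \<ge> 0" for u
    using b_pos[of u] b_nonneg[of "exp (-u)"] pos[of u]
    by (cases "b (exp (-u)) > 0") (auto simp: G_def)
  have b_int: "set_integrable lborel {0<..} (\<lambda>u. b (exp (- u)) * G u)"
  proof -
    obtain B where B: "\<And>x. x \<in> {0..1} \<Longrightarrow> norm (b x) \<le> B"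
      using compact_imp_bounded[OF compact_continuous_image[OF b_cont compact_Icc]]
      by (force simp: bounded_iff)
    show ?thesis
    proof (rule set_integrable_bound[OF set_integrable_mult_right[of B, OF G_int]])
      show "set_borel_measurable lborel {0<..} (\<lambda>u. b (exp (- u)) * G u)"
      proof -
        have "(\<lambda>u. b (exp (-u))) \<in> borel_measurable borel"
          by (intro borel_measurable_continuous_onI continuous_on_compose2[OF b_cont[of UNIV]] continuous_intros) auto
        moreover have "(\<lambda>u. indicator {0<..} u *\<^sub>R G u) \<in> borel_measurable lborel"
          using G_int by (auto simp: set_integrable_def)
        ultimately have "(\<lambda>u. b (exp (-u)) * (indicator {0<..} u *\<^sub>R G u)) \<in> borel_measurable lborel"
          by (intro borel_measurable_times) auto
        then show ?thesis by (simp add: set_borel_measurable_def mult_ac)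
      qed
      have "norm (b (exp (- u)) * G u) \<le> norm (B * G u)" if "u \<in> {0<..}" for u
        using B[of "exp (-u)"] that by (auto simp: abs_mult intro!: mult_right_mono)
      then show "AE u in lborel. u \<in> {0<..} \<longrightarrow> norm (b (exp (- u)) * G u) \<le> norm (B * G u)" by auto
    qed
  qed
  define I where "I = (LBINT u:{0<..}. b (exp (- u)) * G u)"
  define M where "M = (LBINT u:{0<..}. \<bar>G u\<bar>)"
  have M: "M \<ge> 0" unfolding M_def set_lebesgue_integral_def by (intro Bochner_Integration.integral_nonneg) auto
  have small: "\<bar>I\<bar> \<le> e * M" if "e > 0" for e
  proof -
    obtain q where q: "real_polynomial_function q" "\<And>x. x \<in> {0..1} \<Longrightarrow> \<bar>b x - q x\<bar> < e"
      using Stone_Weierstrass_real_polynomial_function[OF compact_Icc b_cont \<open>e > 0\<close>] by blast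
    \<comment> \<open>Subtracting the polynomial term changes nothing, since \<open>poly\<close>
      makes its integral zero; only the approximation error of \<open>b\<close> is left.\<close>
    have "I = (LBINT u:{0<..}. b (exp (- u)) * G u - q (exp (- u)) * G u)"
      using poly[OF q(1)] b_int by (simp add: I_def set_integral_diff)
    also have "\<bar>\<dots>\<bar> \<le> (LBINT u:{0<..}. \<bar>b (exp (- u)) * G u - q (exp (- u)) * G u\<bar>)"
      using set_integral_norm_bound[OF set_integral_diff(1)[OF b_int conjunct1[OF poly[OF q(1)]]]] by simp
    also have "\<dots> \<le> (LBINT u:{0<..}. e * \<bar>G u\<bar>)"
    proof (rule set_integral_mono)
      show "set_integrable lborel {0<..} (\<lambda>u. \<bar>b (exp (- u)) * G u - q (exp (- u)) * G u\<bar>)"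
        using set_integral_diff(1)[OF b_int conjunct1[OF poly[OF q(1)]]] by (rule set_integrable_abs)
      show "set_integrable lborel {0<..} (\<lambda>u. e * \<bar>G u\<bar>)"
        using G_int by (intro set_integrable_mult_right set_integrable_abs)
      fix u :: real assume "u \<in> {0<..}"
      then have "\<bar>b (exp (-u)) - q (exp (-u))\<bar> \<le> e" using q(2)[of "exp (-u)"] by simp
      then show "\<bar>b (exp (- u)) * G u - q (exp (- u)) * G u\<bar> \<le> e * \<bar>G u\<bar>"
        unfolding left_diff_distrib[symmetric] abs_mult by (intro mult_right_mono) auto
    qed
    also have "\<dots> = e * M" by (simp add: M_def)
    finally show ?thesis .
  qed
  have "\<bar>I\<bar> \<le> e" if "e > 0" for e
  proof -
    \<comment> \<open>Dividing by \<open>M + 1\<close> avoids a case distinction for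
      \<open>M = 0\<close>.\<close>
    have "\<bar>I\<bar> \<le> e / (M + 1) * M" using that M by (intro small) auto
    also have "\<dots> \<le> e" using that M by (simp add: field_simps)
    finally show ?thesis .
  qed
  then have "I = 0" by (metis abs_le_zero_iff field_le_epsilon add_0)
  then have "AE u in lborel. indicator {0<..} u *\<^sub>R (b (exp (- u)) * G u) = 0"
    using b_int bG unfolding I_def set_lebesgue_integral_def set_integrable_def
    by (subst (asm) integral_nonneg_eq_0_iff_AE) auto
  \<comment> \<open>On this interval \<open>b (exp (- u)) * G u\<close> is strictly positive, yet it
    vanishes almost everywhere, so an interval of length \<open>2 * d\<close> would be a null
    set.\<close>
  then have "AE u in lborel. u \<notin> {u0 - d<..<u0 + d}"
  proof eventually_elim
    case (elim u)
    then show ?case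
      using b_pos[of u] pos[of u] d by (auto simp: G_def indicator_def split: if_splits)
  qed
  then have "{u0 - d<..<u0 + d} \<in> null_sets lborel"
    by (subst AE_iff_null_sets) auto
  then show False using d by (simp add: null_sets_def)
qed

text \<open>The values at positive integers are moments in the variable \<open>exp (- u)\<close>,
  which already determine a continuous function; the one-sided result is applied to both
  differences.\<close>

lemma laplace_unique:
  fixes f g :: "real \<Rightarrow> real"
  assumes cont: "continuous_on {0<..} f" "continuous_on {0<..} g"
    and f: "\<And>n::nat. n \<ge> 1 \<Longrightarrow> set_integrable lborel {0<..} (\<lambda>u. exp (- u * real n) * f u)"
    and g: "\<And>n::nat. n \<ge> 1 \<Longrightarrow> set_integrable lborel {0<..} (\<lambda>u. exp (- u * real n) * g u)"
    and eq: "\<And>n::nat. n \<ge> 1 \<Longrightarrow>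
      (LBINT u:{0<..}. exp (- u * real n) * f u) = (LBINT u:{0<..}. exp (- u * real n) * g u)"
    and "u > 0"
  shows "f u = g u"
proof (rule antisym)
  have "f u - g u \<le> 0"
    by (rule laplace_unique_nonpos[where g = "\<lambda>u. f u - g u"])
       (use assms in \<open>auto simp: right_diff_distrib set_integral_diff intro!: continuous_intros\<close>)
  then show "f u \<le> g u" by simp
  have "g u - f u \<le> 0"
    by (rule laplace_unique_nonpos[where g = "\<lambda>u. g u - f u"])
       (use assms in \<open>auto simp: right_diff_distrib set_integral_diff intro!: continuous_intros\<close>)
  then show "g u \<le> f u" by simp
qed

subsection \<open>The contour integral\<close>

lemma contour_integral_linepath_same_Im:
  assumes "a < b"
  shows "contour_integral (linepath (Complex a c) (Complex b c)) f = integral {a..b} (\<lambda>x. f (Complex x c))"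
proof -
  have "linepath (Complex a c) (Complex b c) = (+) (\<i> * of_real c) \<circ> linepath (of_real a) (of_real b)"
    by (auto simp: linepath_def Complex_eq scaleR_conv_of_real algebra_simps)
  then show ?thesis
    using assms by (simp add: contour_integral_translate contour_integral_linepath_Reals_eq Complex_eq)
qed

locale subordination_exponent =
  fixes s :: real
  assumes s_pos: "0 < s" and s_less_1: "s < 1"
begin

text \<open>With this angle \<open>s * \<phi> = pi - \<phi>\<close>, so \<open>cos \<phi> = - cos (s * \<phi>)\<close> and one constant controls both exponentials.\<close>

definition \<phi> :: real where "\<phi> = pi / (1 + s)"
definition \<kappa> :: real where "\<kappa> = cos (s * \<phi>)"

lemma phi: "pi / 2 < \<phi>" "\<phi> < pi" "0 < \<phi>" "0 < s * \<phi>" "s * \<phi> < pi / 2" "s * \<phi> = pi - \<phi>"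
proof -
  show a: "pi / 2 < \<phi>" "\<phi> < pi" "0 < \<phi>" "s * \<phi> = pi - \<phi>"
    using s_pos s_less_1 pi_gt_zero unfolding \<phi>_def by (auto simp: field_simps)
  then show "0 < s * \<phi>" "s * \<phi> < pi / 2" by auto
qed

lemma kappa_pos: "0 < \<kappa>"
  unfolding \<kappa>_def using phi by (intro cos_gt_zero) auto

lemma cos_phi: "cos \<phi> = - \<kappa>"
  unfolding \<kappa>_def phi(6) by simp

text \<open>Logarithmic coordinates: points of the plane are written \<open>exp w\<close>, which turns rays into horizontal lines
  and the sector into a strip, and replaces \<open>z powr s\<close> by the entire function \<open>exp (s * w)\<close>.\<close>

definition ray :: "real \<Rightarrow> complex" where "ray y = Complex y \<phi>"

lemma ray_sel [simp]: "Re (ray y) = y" "Im (ray y) = \<phi>"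
  by (auto simp: ray_def)

lemma continuous_on_ray [continuous_intros]:
  "continuous_on A f \<Longrightarrow> continuous_on A (\<lambda>x. ray (f x))"
  unfolding ray_def Complex_eq by (intro continuous_intros)

lemma Re_exp_ray: "Re (exp (ray y)) = - \<kappa> * exp y"
  by (simp add: Re_exp cos_phi)

lemma Re_exp_s_ray: "Re (exp (of_real s * ray y)) = \<kappa> * exp (s * y)"
  by (simp add: Re_exp \<kappa>_def)

text \<open>The cosine decreases on [0, pi] and \<open>s * \<bar>Im w\<bar>\<close> is at most
  \<open>s * \<phi>\<close> < pi / 2, so the real part of exp (s w) is at least
  \<open>\<kappa> * exp (s * Re w)\<close> throughout the closed strip.\<close>

lemma norm_exp_exp_strip:
  assumes "t > 0" "\<bar>Im w\<bar> \<le> \<phi>"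
  shows "norm (exp (- of_real t * exp (of_real s * w))) \<le> exp (- t * \<kappa> * exp (s * Re w))"
proof -
  have "s * \<bar>Im w\<bar> \<le> s * \<phi>"
    using assms(2) s_pos by (intro mult_left_mono) auto
  then have "\<kappa> \<le> cos \<bar>s * Im w\<bar>"
    unfolding \<kappa>_def using assms(2) s_pos phi
    by (intro cos_monotone_0_pi_le) (auto simp: abs_mult)
  then have "\<kappa> \<le> cos (s * Im w)" by simp
  then have "t * exp (s * Re w) * \<kappa> \<le> t * exp (s * Re w) * cos (s * Im w)"
    using assms by (intro mult_left_mono) auto
  then show ?thesis by (simp add: Re_exp mult_ac)
qed

text \<open>In z = exp w this is the Cauchy integrand exp (- t z^s) / (x - z) dz; the extra
  \<open>exp w\<close> in the numerator is the Jacobian.\<close>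

definition cauchy_integrand :: "real \<Rightarrow> real \<Rightarrow> complex \<Rightarrow> complex" where
  "cauchy_integrand x t w = exp (w - of_real t * exp (of_real s * w)) / (of_real x - exp w)"

text \<open>\<open>Ln\<close> inverts \<open>exp\<close> on this strip, so
  \<open>cauchy_integrand\<close> has a single singularity there.\<close>

lemma exp_eq_of_real_strip:
  assumes "x > 0" "\<bar>Im w\<bar> < pi"
  shows "exp w = of_real x \<longleftrightarrow> w = of_real (ln x)"
proof
  assume "exp w = of_real x"
  moreover have "Ln (exp w) = w" using assms by (intro Ln_exp) auto
  ultimately show "w = of_real (ln x)" using assms by (simp add: Ln_of_real)
next
  assume "w = of_real (ln x)"
  then show "exp w = of_real x" using assms by (metis exp_ln exp_of_real)
qed

lemma cauchy_integrand_holomorphic: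
  assumes "x > 0"
  shows "cauchy_integrand x t holomorphic_on {w. \<bar>Im w\<bar> < pi} - {of_real (ln x)}"
  unfolding cauchy_integrand_def using exp_eq_of_real_strip[OF assms]
  by (intro holomorphic_intros) force

lemma open_strip: "open {w::complex. \<bar>Im w\<bar> < pi}"
  by (intro open_Collect_less continuous_intros)

lemma convex_strip: "convex {w::complex. \<bar>Im w\<bar> < pi}"
proof -
  have "{w::complex. \<bar>Im w\<bar> < pi} = {w. - pi < Im w} \<inter> {w. Im w < pi}" by auto
  then show ?thesis by (simp add: convex_Int convex_halfspace_Im_lt convex_halfspace_Im_gt)
qed

text \<open>The pole is simple. The derivative of \<open>exp\<close> at \<open>ln x\<close> equals x
  and cancels the Jacobian; the minus sign comes from the order of terms in
  \<open>x - exp w\<close>.\<close>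

lemma residue_cauchy_integrand:
  assumes "x > 0"
  shows "residue (cauchy_integrand x t) (of_real (ln x)) = - of_real (exp (- t * x powr s))"
proof (rule residue_simple'[OF open_strip])
  let ?p = "complex_of_real (ln x)"
  have ep: "exp ?p = of_real x" using assms by (metis exp_ln exp_of_real)
  have "((\<lambda>w. (exp w - exp ?p) / (w - ?p)) \<longlongrightarrow> exp ?p) (at ?p)"
    using DERIV_exp[of ?p] by (simp add: has_field_derivative_iff)
  from tendsto_divide[OF tendsto_const this, of 1]
  have 1: "((\<lambda>w. (w - ?p) / (exp w - of_real x)) \<longlongrightarrow> 1 / of_real x) (at ?p)"
    using assms by (simp add: ep)
  have "((\<lambda>w. - exp (w - of_real t * exp (of_real s * w))) \<longlongrightarrow>
          - exp (?p - of_real t * exp (of_real s * ?p))) (at ?p)"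
    by (intro tendsto_intros)
  from tendsto_mult[OF this 1]
  have "((\<lambda>w. - exp (w - of_real t * exp (of_real s * w)) * ((w - ?p) / (exp w - of_real x))) \<longlongrightarrow>
          - exp (?p - of_real t * exp (of_real s * ?p)) * (1 / of_real x)) (at ?p)" .
  moreover have "- exp (w - of_real t * exp (of_real s * w)) * ((w - ?p) / (exp w - of_real x))
       = cauchy_integrand x t w * (w - ?p)" for w
    unfolding cauchy_integrand_def
    by (metis minus_diff_eq minus_divide_divide minus_mult_left times_divide_eq_left times_divide_eq_right)
  moreover have "- exp (?p - of_real t * exp (of_real s * ?p)) * (1 / of_real x) = - of_real (exp (- t * x powr s))"
  proof -
    have "exp (of_real s * ?p) = of_real (x powr s)"
      using assms by (simp add: powr_def flip: exp_of_real of_real_mult)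
    then show ?thesis
      using assms by (simp add: exp_diff ep exp_minus field_simps flip: exp_of_real)
  qed
  ultimately show "((\<lambda>w. cauchy_integrand x t w * (w - ?p)) \<longlongrightarrow> - of_real (exp (- t * x powr s))) (at ?p)"
    by (simp only:)
qed (use cauchy_integrand_holomorphic[OF assms] in auto)

text \<open>The lower bound \<open>d\<close> stays a parameter because the ray and the two vertical
  sides of the rectangle keep away from the pole for different reasons.\<close>

lemma norm_cauchy_integrand_strip:
  assumes "t > 0" "\<bar>Im w\<bar> \<le> \<phi>" "norm (of_real x - exp w) \<ge> d" "d > 0"
  shows "norm (cauchy_integrand x t w) \<le> exp (Re w - t * \<kappa> * exp (s * Re w)) / d"
proof -
  have "norm (exp (w - of_real t * exp (of_real s * w))) =
     exp (Re w) * norm (exp (- of_real t * exp (of_real s * w)))"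
    by (simp add: exp_diff exp_minus norm_mult norm_divide norm_inverse field_simps)
  also have "\<dots> \<le> exp (Re w) * exp (- t * \<kappa> * exp (s * Re w))"
    using norm_exp_exp_strip[OF assms(1,2)] by (intro mult_left_mono) auto
  also have "\<dots> = exp (Re w - t * \<kappa> * exp (s * Re w))"
    by (simp flip: exp_add)
  finally show ?thesis
    unfolding cauchy_integrand_def norm_divide using assms by (intro frac_le) auto
qed

lemma norm_cauchy_integrand_ray:
  assumes "t > 0" "x > 0"
  shows "norm (cauchy_integrand x t (ray y)) \<le> exp (y - t * \<kappa> * exp (s * y)) / (x + \<kappa> * exp y)"
proof -
  have "x + \<kappa> * exp y = Re (of_real x - exp (ray y))" by (simp add: Re_exp_ray del: Re_exp)
  also have "\<dots> \<le> norm (of_real x - exp (ray y))" by (rule complex_Re_le_cmod)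
  finally show ?thesis
    using norm_cauchy_integrand_strip[OF assms(1), of "ray y" "x + \<kappa> * exp y" x] assms kappa_pos phi
    by (simp add: add_pos_pos)
qed

lemma integrable_ray_majorant:
  assumes "t > 0" "x > 0"
  shows "integrable lborel (\<lambda>y. exp (y - t * \<kappa> * exp (s * y)) / (x + \<kappa> * exp y))"
proof (rule Bochner_Integration.integrable_bound)
  \<comment> \<open>For y <= 0 the denominator is at least x, and \<open>exp y\<close> <= 1 permits
    the factor exp (1 - exp y). For y > 0 the denominator is at least
    \<open>\<kappa> * exp y\<close>, which cancels \<open>exp y\<close>, and
    \<open>exp (s * y)\<close> >= 1 is inserted to reach an integral known in closed form.\<close>
  let ?g = "\<lambda>y. exp 1 / x * exp (y - exp y) + 1 / \<kappa> * exp (s * y - (t * \<kappa>) * exp (s * y))"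
  show "integrable lborel ?g"
    using has_bochner_integral_exp_exp[of 1 1] has_bochner_integral_exp_exp[of s "t * \<kappa>"] assms s_pos kappa_pos
    by (intro Bochner_Integration.integrable_add integrable_mult_right) (auto simp: has_bochner_integral_iff)
  have "exp (y - t * \<kappa> * exp (s * y)) / (x + \<kappa> * exp y) \<le> ?g y" for y
  proof (cases "y \<le> 0")
    case True
    have "exp (y - t * \<kappa> * exp (s * y)) / (x + \<kappa> * exp y) \<le> exp y / x"
      using assms kappa_pos by (intro frac_le) auto
    also have "exp y \<le> exp 1 * exp (y - exp y)"
      using True by (simp flip: exp_add)
    finally show ?thesis using assms kappa_pos by (simp add: divide_right_mono add_increasing2)
  next
    case False
    have "exp (y - t * \<kappa> * exp (s * y)) / (x + \<kappa> * exp y) \<le> exp (y - t * \<kappa> * exp (s * y)) / (\<kappa> * exp y)"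
      using assms kappa_pos by (intro frac_le) auto
    also have "\<dots> = exp (- (t * \<kappa> * exp (s * y))) / \<kappa>"
      using kappa_pos by (simp add: exp_diff exp_minus field_simps)
    also have "\<dots> \<le> exp (s * y - (t * \<kappa>) * exp (s * y)) / \<kappa>"
      using False s_pos kappa_pos by (intro divide_right_mono) auto
    finally show ?thesis using assms kappa_pos by (simp add: add_increasing)
  qed
  moreover have "0 \<le> exp (y - t * \<kappa> * exp (s * y)) / (x + \<kappa> * exp y)" for y
    using assms kappa_pos by (intro divide_nonneg_pos add_pos_pos) auto
  ultimately show "AE y in lborel. norm (exp (y - t * \<kappa> * exp (s * y)) / (x + \<kappa> * exp y)) \<le> norm (?g y)"
    by (intro AE_I2) (smt (verit) real_norm_def)
qed measurable

lemma continuous_on_cauchy_integrand_ray: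
  assumes "x > 0"
  shows "continuous_on A (\<lambda>y. cauchy_integrand x t (ray y))"
proof (rule continuous_on_compose2[OF holomorphic_on_imp_continuous_on[OF cauchy_integrand_holomorphic[OF assms]]])
  show "ray ` A \<subseteq> {w. \<bar>Im w\<bar> < pi} - {of_real (ln x)}"
    using phi by (auto simp: complex_eq_iff)
qed (intro continuous_intros)

lemma integrable_cauchy_integrand_ray:
  assumes "t > 0" "x > 0"
  shows "integrable lborel (\<lambda>y. cauchy_integrand x t (ray y))"
proof (rule Bochner_Integration.integrable_bound[OF integrable_ray_majorant[OF assms]])
  show "(\<lambda>y. cauchy_integrand x t (ray y)) \<in> borel_measurable lborel"
    using continuous_on_cauchy_integrand_ray[OF assms(2), of UNIV t]
    by (simp add: borel_measurable_continuous_onI)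
  show "AE y in lborel. norm (cauchy_integrand x t (ray y)) \<le> norm (exp (y - t * \<kappa> * exp (s * y)) / (x + \<kappa> * exp y))"
    using norm_cauchy_integrand_ray[OF assms]
    by (intro AE_I2) (auto simp only: real_norm_def intro: order_trans[OF _ abs_ge_self])
qed

text \<open>The residue theorem is applied to the rectangle with corners +-N +-
  \<open>\<i> * \<phi>\<close>, which encloses \<open>ln x\<close> and stays in the strip as
  \<open>\<phi>\<close> < pi. The horizontal sides are conjugate to each other and the vertical ones
  vanish as N grows.\<close>

lemma integral_cauchy_integrand_ray:
  assumes "t > 0" "x > 0"
  shows "Im (LBINT y. cauchy_integrand x t (ray y)) = pi * exp (- t * x powr s)"
proof -
  let ?h = "cauchy_integrand x t"
  let ?J = "\<lambda>N::real. LBINT y:{-N..N}. ?h (ray y)"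
  define R where "R = (\<lambda>N. contour_integral (linepath (Complex N (-\<phi>)) (Complex N \<phi>)) ?h)"
  have cont: "continuous_on A ?h" if "A \<subseteq> {w. \<bar>Im w\<bar> < pi} - {of_real (ln x)}" for A
    using holomorphic_on_imp_continuous_on[OF cauchy_integrand_holomorphic[OF assms(2)]] that
    by (rule continuous_on_subset)
  have vertical: "?h contour_integrable_on (linepath (Complex N (-\<phi>)) (Complex N \<phi>))" if "N \<noteq> ln x" for N
    using that phi by (intro contour_integrable_continuous_linepath cont)
      (auto simp: closed_segment_same_Re closed_segment_eq_real_ivl split: if_splits)
  have lim: "(?J \<longlongrightarrow> (LBINT y. ?h (ray y))) at_top"
    unfolding set_lebesgue_integral_def
  proof (rule integral_dominated_convergence_at_top[where w = "\<lambda>y. norm (?h (ray y))"])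
    have m: "(\<lambda>y. ?h (ray y)) \<in> borel_measurable lborel"
      using integrable_cauchy_integrand_ray[OF assms] by auto
    show "(\<lambda>y. ?h (ray y)) \<in> borel_measurable lborel" by fact
    show "(\<lambda>y. indicator {-N..N} y *\<^sub>R ?h (ray y)) \<in> borel_measurable lborel" for N
      using m by measurable
    show "integrable lborel (\<lambda>y. norm (?h (ray y)))"
      using integrable_cauchy_integrand_ray[OF assms] by (rule integrable_norm)
    have "\<forall>\<^sub>F N in at_top. indicator {-N..N} y *\<^sub>R ?h (ray y) = ?h (ray y)" for y :: real
      using eventually_ge_at_top[of "\<bar>y\<bar>"] by eventually_elim (auto simp: indicator_def)
    then show "AE y in lborel. ((\<lambda>N. indicator {-N..N} y *\<^sub>R ?h (ray y)) \<longlongrightarrow> ?h (ray y)) at_top"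
      by (intro AE_I2 tendsto_eventually)
  qed (auto simp: indicator_def)
  \<comment> \<open>Counterclockwise order: bottom, right, top, left. \<open>R\<close> is oriented
    upwards and \<open>?J\<close> to the right, so top and left carry a minus sign.\<close>
  have eq: "cnj (?J N) + R N - ?J N - R (-N) = - 2 * pi * \<i> * of_real (exp (- t * x powr s))"
    if N: "N > \<bar>ln x\<bar>" for N
  proof -
    let ?a = "Complex (-N) (-\<phi>)" and ?b = "Complex N (-\<phi>)" and ?c = "Complex N \<phi>" and ?d = "Complex (-N) \<phi>"
    have N0: "N > 0" using N by auto
    have horizontal: "continuous_on (closed_segment z z') ?h" if "Im z = Im z'" "\<bar>Im z\<bar> = \<phi>" for z z'
      using that phi by (intro cont) (auto simp: closed_segment_same_Im closed_segment_eq_real_ivl split: if_splits)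
    have vert: "?h contour_integrable_on (linepath ?b ?c)" "?h contour_integrable_on (linepath ?a ?d)"
      using vertical[of N] vertical[of "-N"] N by auto
    have rev: "?h contour_integrable_on (linepath ?d ?a)"
      "contour_integral (linepath ?d ?a) ?h = - R (-N)"
      using vert(2) has_contour_integral_reverse_linepath[OF has_contour_integral_integral[OF vert(2)]]
      by (auto simp: R_def contour_integral_unique contour_integrable_on_def)
    have J: "?J N = integral {-N..N} (\<lambda>y. ?h (ray y))"
      using borel_integrable_atLeastAtMost'[OF continuous_on_cauchy_integrand_ray[OF assms(2)]]
      by (rule set_borel_integral_eq_integral)
    have top: "contour_integral (linepath ?c ?d) ?h = - ?J N"
      using contour_integral_linepath_same_Im[of "-N" N \<phi> ?h] N0 J horizontal[of ?c ?d] phi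
      by (subst contour_integral_reverse_linepath) (auto simp: ray_def)
    \<comment> \<open>Reflection principle: the parameters x, t and s are real.\<close>
    have "?h (Complex y (-\<phi>)) = cnj (?h (ray y))" for y
    proof -
      have "Complex y (-\<phi>) = cnj (ray y)" by (simp add: complex_eq_iff)
      then show ?thesis by (simp add: cauchy_integrand_def exp_cnj)
    qed
    then have bot: "contour_integral (linepath ?a ?b) ?h = cnj (?J N)"
      using contour_integral_linepath_same_Im[of "-N" N "-\<phi>" ?h] N0 J
      by (simp add: integral_cnj)
    have hor: "?h contour_integrable_on (linepath ?a ?b)" "?h contour_integrable_on (linepath ?c ?d)"
      using phi by (auto intro!: contour_integrable_continuous_linepath horizontal)
    have "contour_integral (rectpath ?a ?c) ?h = cnj (?J N) + (R N + (- ?J N + - R (-N)))"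
      unfolding rectpath_def Let_def
      using vert rev hor top bot by (simp add: R_def)
    moreover have "contour_integral (rectpath ?a ?c) ?h =
        2 * pi * \<i> * (\<Sum>p\<in>{of_real (ln x)}. winding_number (rectpath ?a ?c) p * residue ?h p)"
    proof (rule Residue_theorem[OF open_strip])
      show "connected {w::complex. \<bar>Im w\<bar> < pi}" by (intro convex_connected convex_strip)
      show "path_image (rectpath ?a ?c) \<subseteq> {w. \<bar>Im w\<bar> < pi} - {of_real (ln x)}"
        using N phi by (subst path_image_rectpath) auto
      show "\<forall>z. z \<notin> {w. \<bar>Im w\<bar> < pi} \<longrightarrow> winding_number (rectpath ?a ?c) z = 0"
        using N0 phi by (auto intro!: winding_number_rectpath_outside simp: in_cbox_complex_iff)
    qed (use cauchy_integrand_holomorphic[OF assms(2)] in auto)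
    moreover have "winding_number (rectpath ?a ?c) (of_real (ln x)) = 1"
      using N phi by (intro winding_number_rectpath) (auto simp: in_box_complex_iff)
    ultimately show ?thesis
      using residue_cauchy_integrand[OF assms(2)] by simp
  qed
  have len: "norm (Complex a \<phi> - Complex a (-\<phi>)) = 2 * \<phi>" for a
    using phi by (simp add: cmod_def real_sqrt_mult)
  \<comment> \<open>The Jacobian is balanced by the denominator, and the double exponential with
    \<open>\<kappa>\<close> > 0 forces decay.\<close>
  have R_top: "(R \<longlongrightarrow> 0) at_top"
  proof (rule Lim_null_comparison)
    show "\<forall>\<^sub>F N in at_top. norm (R N) \<le> exp (N - t * \<kappa> * exp (s * N)) / (exp N - x) * (2 * \<phi>)"
      using eventually_gt_at_top[of "ln x"]
    proof eventually_elim
      case (elim N)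
      then have d: "exp N - x > 0" using assms(2) by (metis diff_gt_0_iff_gt exp_less_mono exp_ln)
      have "norm (?h w) \<le> exp (N - t * \<kappa> * exp (s * N)) / (exp N - x)"
        if "w \<in> closed_segment (Complex N (-\<phi>)) (Complex N \<phi>)" for w
      proof -
        have w: "Re w = N" "\<bar>Im w\<bar> \<le> \<phi>"
          using that phi by (auto simp: closed_segment_same_Re closed_segment_eq_real_ivl)
        have "exp N - x \<le> norm (of_real x - exp w)"
          using norm_triangle_ineq3[of "exp w" "of_real x"] w assms by (simp add: norm_minus_commute)
        then show ?thesis using norm_cauchy_integrand_strip[OF assms(1) w(2) _ d] w(1) by simp
      qed
      then have "norm (R N) \<le> exp (N - t * \<kappa> * exp (s * N)) / (exp N - x) * norm (Complex N \<phi> - Complex N (-\<phi>))"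
        unfolding R_def using vertical[of N] elim d by (intro contour_integral_bound_linepath) auto
      then show ?case by (simp only: len)
    qed
    have "((\<lambda>N. exp (N - c * exp (s * N)) / (exp N - x) * (2 * \<phi>)) \<longlongrightarrow> 0) at_top" if "c > 0" for c
      using that s_pos by real_asymp
    from this[of "t * \<kappa>"]
    show "((\<lambda>N. exp (N - t * \<kappa> * exp (s * N)) / (exp N - x) * (2 * \<phi>)) \<longlongrightarrow> 0) at_top"
      using assms kappa_pos by simp
  qed
  \<comment> \<open>Here the denominator tends to x and the Jacobian \<open>exp (- N)\<close> alone
    gives decay.\<close>
  have R_bot: "((\<lambda>N. R (- N)) \<longlongrightarrow> 0) at_top"
  proof (rule Lim_null_comparison)
    show "\<forall>\<^sub>F N in at_top. norm (R (-N)) \<le> exp (-N - t * \<kappa> * exp (s * (-N))) / (x - exp (-N)) * (2 * \<phi>)"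
      using eventually_gt_at_top[of "- ln x"]
    proof eventually_elim
      case (elim N)
      then have "-N < ln x" by auto
      then have d: "x - exp (-N) > 0" using assms(2) by (metis diff_gt_0_iff_gt exp_less_mono exp_ln)
      have "norm (?h w) \<le> exp (-N - t * \<kappa> * exp (s * (-N))) / (x - exp (-N))"
        if "w \<in> closed_segment (Complex (-N) (-\<phi>)) (Complex (-N) \<phi>)" for w
      proof -
        have w: "Re w = -N" "\<bar>Im w\<bar> \<le> \<phi>"
          using that phi by (auto simp: closed_segment_same_Re closed_segment_eq_real_ivl)
        have "x - exp (-N) \<le> norm (of_real x - exp w)"
          using norm_triangle_ineq3[of "of_real x" "exp w"] w assms by simp
        then show ?thesis using norm_cauchy_integrand_strip[OF assms(1) w(2) _ d] w(1) by simp
      qed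
      then have "norm (R (-N)) \<le> exp (-N - t * \<kappa> * exp (s * (-N))) / (x - exp (-N)) * norm (Complex (-N) \<phi> - Complex (-N) (-\<phi>))"
        unfolding R_def using vertical[of "-N"] elim d by (intro contour_integral_bound_linepath) auto
      then show ?case by (simp only: len)
    qed
    have "((\<lambda>N. exp (-N - c * exp (s * (-N))) / (x - exp (-N)) * (2 * \<phi>)) \<longlongrightarrow> 0) at_top" if "c > 0" for c
      using that s_pos assms(2) by real_asymp
    from this[of "t * \<kappa>"]
    show "((\<lambda>N. exp (-N - t * \<kappa> * exp (s * (-N))) / (x - exp (-N)) * (2 * \<phi>)) \<longlongrightarrow> 0) at_top"
      using assms kappa_pos by simp
  qed
  let ?I = "LBINT y. ?h (ray y)"
  have "((\<lambda>N. cnj (?J N) + R N - ?J N - R (-N)) \<longlongrightarrow> cnj ?I + 0 - ?I - 0) at_top"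
    by (intro tendsto_intros lim R_top R_bot)
  moreover have "\<forall>\<^sub>F N in at_top. cnj (?J N) + R N - ?J N - R (-N) = - 2 * pi * \<i> * of_real (exp (- t * x powr s))"
    using eventually_gt_at_top[of "\<bar>ln x\<bar>"] by eventually_elim (rule eq)
  then have "((\<lambda>N. cnj (?J N) + R N - ?J N - R (-N)) \<longlongrightarrow> - 2 * pi * \<i> * of_real (exp (- t * x powr s))) at_top"
    by (rule tendsto_eventually)
  ultimately have "cnj ?I + 0 - ?I - 0 = - 2 * pi * \<i> * of_real (exp (- t * x powr s))"
    by (rule tendsto_unique[OF trivial_limit_at_top_linorder])
  \<comment> \<open>The left side is -2 \<open>\<i>\<close> times the imaginary part of
    \<open>?I\<close>.\<close>
  from arg_cong[OF this, of Im] show ?thesis by simp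
qed

subsection \<open>The contour representation of the density\<close>

text \<open>The integrand exp (u z - t z^s) dz of the inverse Laplace transform, pulled back to the
  upper ray by z = \<open>exp (ray y)\<close>.\<close>

definition kernel :: "real \<Rightarrow> real \<Rightarrow> real \<Rightarrow> complex" where
  "kernel u t y = exp (of_real u * exp (ray y) + ray y - of_real t * exp (of_real s * ray y))"

lemma norm_kernel: "norm (kernel u t y) = exp (y - u * \<kappa> * exp y - t * \<kappa> * exp (s * y))"
  unfolding kernel_def norm_exp_eq_Re
  by (simp add: Re_exp_ray Re_exp_s_ray mult_ac del: Re_exp)

lemma continuous_on_kernel [continuous_intros]:
  assumes "continuous_on A f" "continuous_on A g" "continuous_on A h"
  shows "continuous_on A (\<lambda>p. kernel (f p) (g p) (h p))"
  unfolding kernel_def by (intro continuous_intros assms)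

lemma kernel_measurable [measurable]: "kernel u t \<in> borel_measurable borel"
  by (intro borel_measurable_continuous_onI continuous_intros)

lemma norm_kernel_le:
  assumes "a \<le> u" "t \<ge> 0"
  shows "norm (kernel u t y) \<le> exp (y - (a * \<kappa>) * exp y)"
proof -
  have "a * (\<kappa> * exp y) \<le> u * (\<kappa> * exp y)" "0 \<le> t * (\<kappa> * exp (s * y))"
    using assms kappa_pos by (auto intro!: mult_right_mono)
  then show ?thesis by (simp add: norm_kernel mult_ac)
qed

lemma integrable_exp_kappa: "a > 0 \<Longrightarrow> integrable lborel (\<lambda>y. exp (y - (a * \<kappa>) * exp y))"
  using has_bochner_integral_exp_exp[of 1 "a * \<kappa>"] kappa_pos by (simp add: has_bochner_integral_iff)

lemma integrable_kernel:
  assumes "u > 0" "t \<ge> 0"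
  shows "integrable lborel (kernel u t)"
  by (rule Bochner_Integration.integrable_bound[OF integrable_exp_kappa[OF assms(1)]])
     (use norm_kernel_le[OF order_refl assms(2), of u] in \<open>auto simp: norm_kernel\<close>)

text \<open>The lower ray contributes the conjugate of the upper one, so the Bromwich factor 1 / (2
  pi i) applied to their difference leaves Im / pi on the upper ray.\<close>

definition density :: "real \<Rightarrow> real \<Rightarrow> real" where
  "density t u = (LBINT y. Im (kernel u t y)) / pi"

lemma continuous_on_density:
  assumes "t \<ge> 0"
  shows "continuous_on {0<..} (density t)"
proof -
  \<comment> \<open>The dominating function needs u bounded away from 0, so continuity is first
    shown on each \<open>{a<..}\<close>.\<close>
  have cont: "continuous_on {a<..} (density t)" if "a > 0" for a
    unfolding continuous_on_sequentially
  proof (intro allI ballI impI)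
    fix X :: "nat \<Rightarrow> real" and u
    assume u: "u \<in> {a<..}" and X: "(\<forall>n. X n \<in> {a<..}) \<and> X \<longlonglongrightarrow> u"
    have "(\<lambda>n. LBINT y. Im (kernel (X n) t y)) \<longlonglongrightarrow> (LBINT y. Im (kernel u t y))"
    proof (rule integral_dominated_convergence[OF _ _ integrable_exp_kappa[OF \<open>a > 0\<close>]])
      have "(\<lambda>n. kernel (X n) t y) \<longlonglongrightarrow> kernel u t y" for y
        unfolding kernel_def using X by (intro tendsto_intros) auto
      then show "AE y in lborel. (\<lambda>n. Im (kernel (X n) t y)) \<longlonglongrightarrow> Im (kernel u t y)"
        by (intro AE_I2 tendsto_Im)
      have "norm (Im (kernel (X n) t y)) \<le> exp (y - (a * \<kappa>) * exp y)" for n y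
      proof -
        have "a \<le> X n" using X by (simp add: less_imp_le)
        from order_trans[OF abs_Im_le_cmod norm_kernel_le[OF this assms]] show ?thesis
          unfolding real_norm_def .
      qed
      then show "AE y in lborel. norm (Im (kernel (X n) t y)) \<le> exp (y - (a * \<kappa>) * exp y)" for n
        by blast
    qed auto
    then show "(density t \<circ> X) \<longlonglongrightarrow> density t u"
      unfolding density_def o_def by (intro tendsto_intros) auto
  qed
  show ?thesis
    unfolding continuous_on_eq_continuous_at[OF open_greaterThan]
  proof
    fix u :: real assume "u \<in> {0<..}"
    then show "isCont (density t) u"
      using cont[of "u / 2"] by (auto intro: continuous_on_interior simp: interior_open)
  qed
qed

text \<open>Exchanging the integrals, the one in u turns \<open>exp (- u * x) * kernel u t y\<close>
  into \<open>cauchy_integrand x t (ray y)\<close>; it converges because the ray lies in the left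
  half-plane.\<close>

lemma laplace_density:
  assumes "t > 0" "x > 0"
  shows "set_integrable lborel {0<..} (\<lambda>u. exp (- u * x) * density t u)"
    and "(LBINT u:{0<..}. exp (- u * x) * density t u) = exp (- t * x powr s)"
proof -
  define F where "F = (\<lambda>y u. indicator {0<..} u *\<^sub>R (of_real (exp (- u * x)) * kernel u t y))"
  have F_eq: "F y u = exp (ray y - of_real t * exp (of_real s * ray y)) *
      (indicator {0<..} u *\<^sub>R exp (- of_real u * (of_real x - exp (ray y))))" for y u
  proof -
    have "exp (of_real (- u * x)) * kernel u t y = exp (ray y - of_real t * exp (of_real s * ray y)) *
        exp (- of_real u * (of_real x - exp (ray y)))"
      unfolding kernel_def exp_add[symmetric] by (simp add: algebra_simps)
    then show ?thesis unfolding exp_of_real by (simp add: F_def)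
  qed
  have z: "Re (of_real x - exp (ray y)) > 0" for y
    using assms kappa_pos by (simp add: Re_exp_ray add_pos_pos del: Re_exp)
  have int_y: "integrable lborel (F y)" for y
    unfolding F_eq using halfline_exp_integral(1)[OF z[of y]]
    by (intro integrable_mult_right) (simp add: set_integrable_def)
  have lint_y: "(LBINT u. F y u) = cauchy_integrand x t (ray y)" for y
    unfolding F_eq using halfline_exp_integral(2)[OF z[of y]]
    by (simp add: set_lebesgue_integral_def cauchy_integrand_def del: mult_scaleR_right)
  have norm_y: "(LBINT u. norm (F y u)) = exp (y - t * \<kappa> * exp (s * y)) / (x + \<kappa> * exp y)" for y
  proof -
    have "norm (F y u) = exp (y - t * \<kappa> * exp (s * y)) * (indicator {0<..} u *\<^sub>R exp (- u * (x + \<kappa> * exp y)))" for u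
    proof -
      have "exp (- u * x) * exp (y - u * \<kappa> * exp y - t * \<kappa> * exp (s * y))
          = exp (y - t * \<kappa> * exp (s * y)) * exp (- u * (x + \<kappa> * exp y))"
        unfolding exp_add[symmetric] by (simp add: algebra_simps)
      then show ?thesis by (simp add: F_def norm_mult norm_kernel)
    qed
    then have "(LBINT u. norm (F y u)) = exp (y - t * \<kappa> * exp (s * y)) * (LBINT u:{0<..}. exp (- u * (x + \<kappa> * exp y)))"
      by (simp add: set_lebesgue_integral_def)
    then show ?thesis
      using halfline_exp_integral_real(2)[of "x + \<kappa> * exp y"] assms kappa_pos by (simp add: add_pos_pos)
  qed
  have meas: "case_prod F \<in> borel_measurable (lborel \<Otimes>\<^sub>M lborel)"
  proof -
    have "(\<lambda>p. of_real (exp (- snd p * x)) * kernel (snd p) t (fst p)) \<in> borel_measurable (borel :: (real \<times> real) measure)"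
      by (intro borel_measurable_continuous_onI continuous_intros)
    then have [measurable]: "(\<lambda>p. of_real (exp (- snd p * x)) * kernel (snd p) t (fst p)) \<in> borel_measurable (lborel \<Otimes>\<^sub>M lborel)"
      by (simp add: borel_prod[symmetric])
    show ?thesis unfolding F_def case_prod_beta by measurable
  qed
  \<comment> \<open>By \<open>norm_y\<close>, integrating the norm over u gives exactly the function
    of \<open>integrable_ray_majorant\<close>.\<close>
  have F_int: "integrable (lborel \<Otimes>\<^sub>M lborel) (case_prod F)"
    using meas integrable_ray_majorant[OF assms] int_y
    by (intro lborel_pair.Fubini_integrable) (auto simp: norm_y)
  have Im_eq: "Im (LBINT y. F y u) = pi * (indicator {0<..} u *\<^sub>R (exp (- u * x) * density t u))" for u
  proof (cases "u > 0")
    case True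
    have "(LBINT y. F y u) = of_real (exp (- u * x)) * (LBINT y. kernel u t y)"
      using True by (simp add: F_def)
    also have "Im \<dots> = exp (- u * x) * (LBINT y. Im (kernel u t y))"
      using integrable_kernel[of u t] True assms by (simp add: integral_Im)
    finally show ?thesis using True by (simp add: density_def)
  qed (simp add: F_def)
  have Fu: "integrable lborel (\<lambda>u. LBINT y. F y u)"
    using lborel_pair.integrable_snd[OF F_int] .
  from integrable_Im[OF this] show "set_integrable lborel {0<..} (\<lambda>u. exp (- u * x) * density t u)"
    unfolding Im_eq set_integrable_def by simp
  have "pi * (LBINT u:{0<..}. exp (- u * x) * density t u) = (LBINT u. Im (LBINT y. F y u))"
    unfolding Im_eq set_lebesgue_integral_def by simp
  also have "\<dots> = Im (LBINT u. LBINT y. F y u)"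
    using Fu by (rule integral_Im)
  also have "(LBINT u. LBINT y. F y u) = (LBINT y. LBINT u. F y u)"
    using lborel_pair.Fubini_integral[OF F_int] .
  also have "Im \<dots> = pi * exp (- t * x powr s)"
    unfolding lint_y using integral_cauchy_integrand_ray[OF assms] .
  finally show "(LBINT u:{0<..}. exp (- u * x) * density t u) = exp (- t * x powr s)"
    by simp
qed

text \<open>The defining conditions constrain each t separately; regularity in t enters only through
  this identification.\<close>

lemma subordination_density_eq_density:
  assumes "t > 0" "subordination_density s t f" "u > 0"
  shows "f u = density t u"
  using assms laplace_density[OF assms(1)] continuous_on_density[of t]
  by (intro laplace_unique[of f "density t" u]) (auto simp: subordination_density_def)

section \<open>Differentiation in t and integration of the derivative\<close>

definition kernel_deriv :: "real \<Rightarrow> real \<Rightarrow> real \<Rightarrow> real" where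
  "kernel_deriv u t y = - Im (exp (of_real s * ray y) * kernel u t y)"

lemma continuous_on_kernel_deriv [continuous_intros]:
  assumes "continuous_on A f" "continuous_on A g" "continuous_on A h"
  shows "continuous_on A (\<lambda>p. kernel_deriv (f p) (g p) (h p))"
  unfolding kernel_deriv_def by (intro continuous_intros assms)

lemma kernel_deriv_measurable [measurable]: "kernel_deriv u t \<in> borel_measurable borel"
  by (intro borel_measurable_continuous_onI continuous_intros)

lemma DERIV_kernel: "((\<lambda>t. Im (kernel u t y)) has_field_derivative kernel_deriv u t y) (at t within A)"
proof -
  have "((\<lambda>t. kernel u t y) has_vector_derivative - (exp (of_real s * ray y) * kernel u t y)) (at t within A)"
    unfolding kernel_def
    by (rule has_vector_derivative_real_field) (auto intro!: derivative_eq_intros)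
  from bounded_linear.has_vector_derivative[OF bounded_linear_Im this]
  show ?thesis
    by (simp add: kernel_deriv_def has_real_derivative_iff_has_vector_derivative)
qed

text \<open>The bound is split so that t occurs only in the last factor; multiplied by
  \<open>exp (s * y)\<close>, that factor has t-integral \<open>1 / \<kappa>\<close> for every
  y.\<close>

lemma abs_kernel_deriv_le:
  "\<bar>kernel_deriv u t y\<bar> \<le> exp (y - (u * \<kappa>) * exp y) * (exp (s * y) * exp (- t * (\<kappa> * exp (s * y))))"
proof -
  have "\<bar>kernel_deriv u t y\<bar> \<le> norm (exp (of_real s * ray y) * kernel u t y)"
    unfolding kernel_deriv_def abs_minus_cancel by (rule abs_Im_le_cmod)
  also have "\<dots> = exp (y - (u * \<kappa>) * exp y) * (exp (s * y) * exp (- t * (\<kappa> * exp (s * y))))"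
    unfolding norm_mult norm_kernel norm_exp_eq_Re exp_add[symmetric] by (simp add: algebra_simps)
  finally show ?thesis .
qed

text \<open>\<open>mult_exp_minus_le\<close> at v = \<open>exp (s * y)\<close> removes the growth in
  y, giving a majorant uniform in t >= a for differentiating under the integral.\<close>

lemma abs_kernel_deriv_le':
  assumes "0 < a" "a \<le> t"
  shows "\<bar>kernel_deriv u t y\<bar> \<le> 1 / (a * \<kappa>) * exp (y - (u * \<kappa>) * exp y)"
proof -
  have "exp (s * y) * exp (- t * (\<kappa> * exp (s * y))) \<le> exp (s * y) * exp (- (a * \<kappa>) * exp (s * y))"
    using assms kappa_pos by (intro mult_left_mono) auto
  also have "\<dots> \<le> 1 / (a * \<kappa>)"
    using assms kappa_pos by (intro mult_exp_minus_le) auto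
  finally have "exp (y - (u * \<kappa>) * exp y) * (exp (s * y) * exp (- t * (\<kappa> * exp (s * y))))
      \<le> exp (y - (u * \<kappa>) * exp y) * (1 / (a * \<kappa>))"
    by (intro mult_left_mono) auto
  with abs_kernel_deriv_le[of u t y] show ?thesis by simp
qed

lemma DERIV_density:
  assumes "t > 0" "u > 0"
  shows "((\<lambda>t. density t u) has_field_derivative (LBINT y. kernel_deriv u t y) / pi) (at t)"
proof -
  define a where "a = t / 2"
  have a: "a > 0" "t \<in> {a<..}" using assms by (auto simp: a_def)
  define w where "w = (\<lambda>y. 1 / (a * \<kappa>) * exp (y - (u * \<kappa>) * exp y))"
  have w: "integrable lborel w"
    unfolding w_def by (intro integrable_mult_right integrable_exp_kappa assms)
  \<comment> \<open>Mean value inequality on the convex set \<open>{a<..}\<close>: \<open>w\<close>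
    dominates all difference quotients at t with the other point in this set.\<close>
  have lip: "\<bar>Im (kernel u r y) - Im (kernel u t y)\<bar> \<le> w y * \<bar>r - t\<bar>" if "r \<in> {a<..}" for r y
    using field_differentiable_bound[of "{a<..}" "\<lambda>t. Im (kernel u t y)" "\<lambda>t. kernel_deriv u t y" "w y" r t]
      abs_kernel_deriv_le'[OF a(1), of _ u y] that a(2) DERIV_kernel
    by (auto simp: w_def)
  have "((\<lambda>r. LBINT y. Im (kernel u r y)) has_field_derivative (LBINT y. kernel_deriv u t y)) (at t within {a<..})"
    unfolding has_field_derivative_iff tendsto_at_iff_sequentially o_def
  proof (intro allI impI)
    fix X :: "nat \<Rightarrow> real"
    assume X: "\<forall>i. X i \<in> {a<..} - {t}" and lim: "X \<longlonglongrightarrow> t"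
    have "((LBINT y. Im (kernel u (X n) y)) - (LBINT y. Im (kernel u t y))) / (X n - t)
        = (LBINT y. (Im (kernel u (X n) y) - Im (kernel u t y)) / (X n - t))" for n
    proof -
      have "X n \<ge> 0" using X a(1) by (force intro: less_imp_le less_trans)
      then show ?thesis
        using assms integrable_kernel[of u "X n"] integrable_kernel[of u t] by simp
    qed
    moreover have "(\<lambda>n. LBINT y. (Im (kernel u (X n) y) - Im (kernel u t y)) / (X n - t)) \<longlonglongrightarrow> (LBINT y. kernel_deriv u t y)"
    proof (rule integral_dominated_convergence[OF _ _ w])
      show "AE y in lborel. (\<lambda>n. (Im (kernel u (X n) y) - Im (kernel u t y)) / (X n - t)) \<longlonglongrightarrow> kernel_deriv u t y"
        using DERIV_kernel[of u _ t "{a<..}"] X lim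
        unfolding has_field_derivative_iff tendsto_at_iff_sequentially o_def by blast
      have "norm ((Im (kernel u (X n) y) - Im (kernel u t y)) / (X n - t)) \<le> w y" for n y
        using lip[of "X n" y] X by (auto simp: divide_le_eq)
      then show "AE y in lborel. norm ((Im (kernel u (X n) y) - Im (kernel u t y)) / (X n - t)) \<le> w y" for n
        by blast
    qed auto
    ultimately show "(\<lambda>n. ((LBINT y. Im (kernel u (X n) y)) - (LBINT y. Im (kernel u t y))) / (X n - t)) \<longlonglongrightarrow> (LBINT y. kernel_deriv u t y)"
      by (simp only:)
  qed
  then have "((\<lambda>r. LBINT y. Im (kernel u r y)) has_field_derivative (LBINT y. kernel_deriv u t y)) (at t)"
    using a by (simp add: at_within_open[OF _ open_greaterThan])
  then show ?thesis
    unfolding density_def by (rule DERIV_cdivide)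
qed

lemma integral_kernel_deriv:
  assumes "u > 0"
  shows "set_integrable lborel {0<..} (\<lambda>t. LBINT y. kernel_deriv u t y)"
    and "(LBINT t:{0<..}. \<bar>LBINT y. kernel_deriv u t y\<bar>) \<le> 1 / (\<kappa>\<^sup>2 * u)"
proof -
  \<comment> \<open>\<open>m\<close> is the majorant from \<open>abs_kernel_deriv_le\<close>, cut
    off to t > 0 and arranged so that the t-integral can be read off.\<close>
  define m where "m = (\<lambda>y t. exp (y - (u * \<kappa>) * exp y) *
      (exp (s * y) * (indicator {0<..} t *\<^sub>R exp (- t * (\<kappa> * exp (s * y))))))"
  define f where "f = (\<lambda>y t. indicator {0<..} t *\<^sub>R kernel_deriv u t y)"
  have c: "\<kappa> * exp (s * y) > 0" for y using kappa_pos by simp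
  have m_nonneg: "m y t \<ge> 0" for y t by (simp add: m_def)
  have fm: "\<bar>f y t\<bar> \<le> m y t" for y t
    using abs_kernel_deriv_le[of u t y] by (simp add: f_def m_def indicator_def)
  have int_y: "integrable lborel (m y)" for y
    unfolding m_def using halfline_exp_integral_real(1)[OF c[of y]]
    by (intro integrable_mult_right) (simp add: set_integrable_def)
  have m_y: "(LBINT t. m y t) = 1 / \<kappa> * exp (y - (u * \<kappa>) * exp y)" for y
    unfolding m_def using halfline_exp_integral_real(2)[OF c[of y]]
    by (simp add: set_lebesgue_integral_def)
  have m_meas: "case_prod m \<in> borel_measurable (lborel \<Otimes>\<^sub>M lborel)"
    unfolding m_def case_prod_beta by measurable
  have f_meas: "case_prod f \<in> borel_measurable (lborel \<Otimes>\<^sub>M lborel)"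
  proof -
    have "(\<lambda>p. kernel_deriv u (snd p) (fst p)) \<in> borel_measurable (borel :: (real \<times> real) measure)"
      by (intro borel_measurable_continuous_onI continuous_intros)
    then have [measurable]: "(\<lambda>p. kernel_deriv u (snd p) (fst p)) \<in> borel_measurable (lborel \<Otimes>\<^sub>M lborel)"
      by (simp add: borel_prod[symmetric])
    show ?thesis unfolding f_def case_prod_beta by measurable
  qed
  have m_int: "integrable (lborel \<Otimes>\<^sub>M lborel) (case_prod m)"
    using m_meas int_y integrable_exp_kappa[OF assms]
    by (intro lborel_pair.Fubini_integrable) (auto simp: m_nonneg m_y)
  have f_int: "integrable (lborel \<Otimes>\<^sub>M lborel) (case_prod f)"
    using fm by (intro Bochner_Integration.integrable_bound[OF m_int f_meas] AE_I2)
      (auto intro: order_trans[OF _ abs_ge_self])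
  have f_eq: "(LBINT y. f y t) = indicator {0<..} t *\<^sub>R (LBINT y. kernel_deriv u t y)" for t
    by (simp add: f_def)
  have fi: "integrable lborel (\<lambda>t. LBINT y. f y t)"
    using lborel_pair.integrable_snd[OF f_int] .
  then show "set_integrable lborel {0<..} (\<lambda>t. LBINT y. kernel_deriv u t y)"
    unfolding set_integrable_def f_eq .
  have "(LBINT t:{0<..}. \<bar>LBINT y. kernel_deriv u t y\<bar>) = (LBINT t. \<bar>LBINT y. f y t\<bar>)"
    unfolding f_eq set_lebesgue_integral_def by (simp add: abs_mult)
  also have "\<dots> \<le> (LBINT t. LBINT y. m y t)"
  proof (rule integral_mono_AE)
    \<comment> \<open>Fubini gives integrability in y only for almost every t.\<close>
    show "AE t in lborel. \<bar>LBINT y. f y t\<bar> \<le> (LBINT y. m y t)"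
      using lborel_pair.AE_integrable_snd[OF m_int] lborel_pair.AE_integrable_snd[OF f_int]
    proof eventually_elim
      case (elim t)
      then show ?case
        unfolding real_norm_def[symmetric] by (intro Bochner_Integration.integral_norm_bound_integral) (auto simp: fm)
    qed
  qed (use fi lborel_pair.integrable_snd[OF m_int] in auto)
  also have "\<dots> = (LBINT y. LBINT t. m y t)"
    using lborel_pair.Fubini_integral[OF m_int] .
  \<comment> \<open>One factor \<open>1 / \<kappa>\<close> comes from the t-integral, the other from
    the y-integral, which equals \<open>1 / (u * \<kappa>)\<close>.\<close>
  also have "\<dots> = 1 / (\<kappa>\<^sup>2 * u)"
    unfolding m_y using has_bochner_integral_exp_exp[of 1 "u * \<kappa>"] assms kappa_pos
    by (simp add: has_bochner_integral_iff power2_eq_square mult_ac)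
  finally show "(LBINT t:{0<..}. \<bar>LBINT y. kernel_deriv u t y\<bar>) \<le> 1 / (\<kappa>\<^sup>2 * u)" .
qed

end

section \<open>Transfer to an arbitrary family of subordination densities\<close>

theorem proposition4p3:
  fixes s :: real
  assumes "0 < s" and "s < 1"
  shows "\<exists>C>0. \<forall>\<eta> :: real \<Rightarrow> real \<Rightarrow> real.
           (\<forall>t>0. subordination_density s t (\<eta> t)) \<longrightarrow>
           (\<forall>u>0.
              (\<forall>t>0. (\<lambda>\<tau>. \<eta> \<tau> u) differentiable (at t)) \<and>
              set_integrable lborel {0<..} (\<lambda>t. deriv (\<lambda>\<tau>. \<eta> \<tau> u) t) \<and>
              (LBINT t:{0<..}. \<bar>deriv (\<lambda>\<tau>. \<eta> \<tau> u) t\<bar>) \<le> C / u)"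
proof -
  interpret subordination_exponent s by standard fact+
  show ?thesis
  \<comment> \<open>The constant is that of \<open>integral_kernel_deriv\<close> divided by the pi
    in \<open>density\<close>; \<open>\<kappa>\<close> depends on s alone.\<close>
  proof (intro exI[of _ "1 / (pi * \<kappa>\<^sup>2)"] conjI allI impI)
    show "1 / (pi * \<kappa>\<^sup>2) > 0" using kappa_pos by simp
    fix \<eta> :: "real \<Rightarrow> real \<Rightarrow> real" and u :: real
    assume eta: "\<forall>t>0. subordination_density s t (\<eta> t)" and u: "u > 0"
    let ?D = "\<lambda>t. (LBINT y. kernel_deriv u t y) / pi"
    have D: "((\<lambda>\<tau>. \<eta> \<tau> u) has_field_derivative ?D t) (at t)" if "t > 0" for t
    \<comment> \<open>Equality with \<open>density\<close> holds for all \<open>\<tau>\<close> > 0,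
      an open set around t, so the derivative carries over.\<close>
    proof (rule has_field_derivative_transform_within_open[OF DERIV_density[OF that u] open_greaterThan])
      show "t \<in> {0<..}" using that by simp
      show "density \<tau> u = \<eta> \<tau> u" if "\<tau> \<in> {0<..}" for \<tau>
        using subordination_density_eq_density[of \<tau> "\<eta> \<tau>" u] eta u that by simp
    qed
    show "(\<lambda>\<tau>. \<eta> \<tau> u) differentiable (at t)" if "t > 0" for t
      using D[OF that] by (auto simp: real_differentiable_def)
    have deriv: "deriv (\<lambda>\<tau>. \<eta> \<tau> u) t = ?D t" if "t > 0" for t
      using D[OF that] by (rule DERIV_imp_deriv)
    have "set_integrable lborel {0<..} ?D"
      using integral_kernel_deriv(1)[OF u] by (rule set_integrable_divide)
    then show "set_integrable lborel {0<..} (\<lambda>t. deriv (\<lambda>\<tau>. \<eta> \<tau> u) t)"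
      unfolding set_integrable_def
      by (rule Bochner_Integration.integrable_cong[OF refl, THEN iffD1, rotated]) (simp add: deriv indicator_def)
    have "(LBINT t:{0<..}. \<bar>deriv (\<lambda>\<tau>. \<eta> \<tau> u) t\<bar>) = (LBINT t:{0<..}. \<bar>LBINT y. kernel_deriv u t y\<bar> / pi)"
      by (intro set_lebesgue_integral_cong) (auto simp: deriv)
    also have "\<dots> = (LBINT t:{0<..}. \<bar>LBINT y. kernel_deriv u t y\<bar>) / pi"
      by simp
    also have "\<dots> \<le> 1 / (\<kappa>\<^sup>2 * u) / pi"
      using integral_kernel_deriv(2)[OF u] by (intro divide_right_mono) auto
    also have "\<dots> = 1 / (pi * \<kappa>\<^sup>2) / u" by (simp add: mult_ac)
    finally show "(LBINT t:{0<..}. \<bar>deriv (\<lambda>\<tau>. \<eta> \<tau> u) t\<bar>) \<le> 1 / (pi * \<kappa>\<^sup>2) / u" .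
  qed
qed

end
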